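(* For every integer $N \geq 2$, the word problem in the one-relation monoid $\Pi_N = \mathrm{Mon}\langle a,b \mid baa(ba)^N = a\rangle$ is decidable. In particular, the Dehn function of $\Pi_N$ is recursive.
   Context: $\mathrm{Mon}\langle A \mid u=v\rangle$ denotes the quotient of the free monoid $A^\ast$ by the least congruence containing $(u,v)$. The word problem asks for an algorithm which, given two words $w_1,w_2\in A^\ast$, decides whether they are equal in the monoid. An elementary transformation is a single application of the defining relation (in either direction) to a subword. For words $u,v$ equal in the monoid $M$, $\partial_M(u,v)$ is the length of a shortest sequence of elementary transformations transforming $u$ into $v$, and the Dehn function is $\partial_M(n)=\max\{\partial_M(u,v) : u,v\in A^\ast,\ u=_M v,\ |u|+|v|\le n\}$. *)

theory Defs
  imports "HOL-Library.Nat_Bijection" "HOL-Algebra.Group"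
begin

section \<open>One-relation monoids\<close>

text \<open>The alphabet is the whole type \<open>'a\<close>, and the free monoid on it is \<open>'a list\<close> under append.\<close>

inductive_set rel_cong :: "'a list \<Rightarrow> 'a list \<Rightarrow> ('a list \<times> 'a list) set"
  for u v :: "'a list" where
  base: "(u, v) \<in> rel_cong u v"
| refl: "(x, x) \<in> rel_cong u v"
| sym: "(x, y) \<in> rel_cong u v \<Longrightarrow> (y, x) \<in> rel_cong u v"
| trans: "(x, y) \<in> rel_cong u v \<Longrightarrow> (y, z) \<in> rel_cong u v \<Longrightarrow> (x, z) \<in> rel_cong u v"
| append: "(x, x') \<in> rel_cong u v \<Longrightarrow> (y, y') \<in> rel_cong u v \<Longrightarrow> (x @ y, x' @ y') \<in> rel_cong u v"

definition Mon :: "'a list \<Rightarrow> 'a list \<Rightarrow> 'a list set monoid" where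
  "Mon u v =
     \<lparr>carrier = UNIV // rel_cong u v,
      mult = (\<lambda>X Y. rel_cong u v `` {x @ y | x y. x \<in> X \<and> y \<in> Y}),
      one = rel_cong u v `` {[]}\<rparr>"

definition word_val :: "'a list \<Rightarrow> 'a list \<Rightarrow> 'a list \<Rightarrow> 'a list set" where
  "word_val u v w = rel_cong u v `` {w}"

lemma equiv_rel_cong: "equiv UNIV (rel_cong u v)"
  by (rule equivI) (auto intro!: refl_onI symI transI intro: rel_cong.intros)

lemma word_val_eq_iff: "word_val u v x = word_val u v y \<longleftrightarrow> (x, y) \<in> rel_cong u v"
  unfolding word_val_def using eq_equiv_class_iff[OF equiv_rel_cong, of x y] by simp

lemma word_val_in_carrier: "word_val u v w \<in> carrier (Mon u v)"
  by (simp add: word_val_def Mon_def quotientI)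

lemma word_val_Nil: "word_val u v [] = \<one>\<^bsub>Mon u v\<^esub>"
  by (simp add: word_val_def Mon_def)

lemma word_val_append: "word_val u v (x @ y) = word_val u v x \<otimes>\<^bsub>Mon u v\<^esub> word_val u v y"
  by (auto simp: word_val_def Mon_def Image_def intro: rel_cong.intros)

lemma carrier_MonE:
  assumes "X \<in> carrier (Mon u v)"
  obtains x where "X = word_val u v x"
  using assms by (auto simp: Mon_def word_val_def elim: quotientE)

lemma monoid_Mon: "monoid (Mon u v)"
proof (rule monoidI)
  fix X Y assume "X \<in> carrier (Mon u v)" "Y \<in> carrier (Mon u v)"
  then show "X \<otimes>\<^bsub>Mon u v\<^esub> Y \<in> carrier (Mon u v)"
    by (metis carrier_MonE word_val_append word_val_in_carrier)
next
  show "\<one>\<^bsub>Mon u v\<^esub> \<in> carrier (Mon u v)"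
    by (metis word_val_Nil word_val_in_carrier)
next
  fix X Y Z
  assume "X \<in> carrier (Mon u v)" "Y \<in> carrier (Mon u v)" "Z \<in> carrier (Mon u v)"
  then show "X \<otimes>\<^bsub>Mon u v\<^esub> Y \<otimes>\<^bsub>Mon u v\<^esub> Z = X \<otimes>\<^bsub>Mon u v\<^esub> (Y \<otimes>\<^bsub>Mon u v\<^esub> Z)"
    by (metis carrier_MonE word_val_append append_assoc)
next
  fix X assume "X \<in> carrier (Mon u v)"
  then show "\<one>\<^bsub>Mon u v\<^esub> \<otimes>\<^bsub>Mon u v\<^esub> X = X"
    by (metis carrier_MonE word_val_append word_val_Nil append_Nil)
next
  fix X assume "X \<in> carrier (Mon u v)"
  then show "X \<otimes>\<^bsub>Mon u v\<^esub> \<one>\<^bsub>Mon u v\<^esub> = X"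
    by (metis carrier_MonE word_val_append word_val_Nil append_Nil2)
qed


section \<open>Elementary transformations and the Dehn function\<close>

definition elem_trans :: "'a list \<Rightarrow> 'a list \<Rightarrow> ('a list \<times> 'a list) set" where
  "elem_trans u v =
     {(p @ u @ q, p @ v @ q) | p q. True} \<union> {(p @ v @ q, p @ u @ q) | p q. True}"

definition trans_dist :: "'a list \<Rightarrow> 'a list \<Rightarrow> 'a list \<Rightarrow> 'a list \<Rightarrow> nat" where
  "trans_dist u v x y = (LEAST k. (x, y) \<in> elem_trans u v ^^ k)"

definition dehn :: "'a list \<Rightarrow> 'a list \<Rightarrow> nat \<Rightarrow> nat" where
  "dehn u v n =
     Max {trans_dist u v x y | x y. word_val u v x = word_val u v y \<and> length x + length y \<le> n}"

text \<open>
  The next lemmas show that the \<open>LEAST\<close> and \<open>Max\<close> above are never taken over an empty set, and the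
  maximum is over a finite set when the alphabet is finite.
\<close>

lemma elem_trans_append:
  assumes "(x, y) \<in> elem_trans u v"
  shows "(p @ x @ q, p @ y @ q) \<in> elem_trans u v"
proof -
  from assms obtain r s where
    "(x = r @ u @ s \<and> y = r @ v @ s) \<or> (x = r @ v @ s \<and> y = r @ u @ s)"
    by (auto simp: elem_trans_def)
  then have "(p @ x @ q = (p @ r) @ u @ (s @ q) \<and> p @ y @ q = (p @ r) @ v @ (s @ q)) \<or>
             (p @ x @ q = (p @ r) @ v @ (s @ q) \<and> p @ y @ q = (p @ r) @ u @ (s @ q))"
    by auto
  then show ?thesis unfolding elem_trans_def by blast
qed

lemma elem_trans_rtrancl_append:
  assumes "(x, y) \<in> (elem_trans u v)\<^sup>*"
  shows "(p @ x @ q, p @ y @ q) \<in> (elem_trans u v)\<^sup>*"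
  using assms
  by (induction rule: rtrancl_induct) (auto intro: elem_trans_append rtrancl.rtrancl_into_rtrancl)

lemma rel_cong_eq_rtrancl: "rel_cong u v = (elem_trans u v)\<^sup>*"
proof (intro subset_antisym subrelI)
  fix x y assume "(x, y) \<in> rel_cong u v"
  then show "(x, y) \<in> (elem_trans u v)\<^sup>*"
  proof induction
    case base
    have "([] @ u @ [], [] @ v @ []) \<in> elem_trans u v" unfolding elem_trans_def by blast
    then show ?case by simp
  next
    case (sym x y)
    moreover have "Relation.sym (elem_trans u v)"
      by (rule symI) (auto simp: elem_trans_def)
    ultimately show ?case by (meson sym_rtrancl symD)
  next
    case (append x x' y y')
    from elem_trans_rtrancl_append[OF append.IH(1), of "[]" y]
      elem_trans_rtrancl_append[OF append.IH(2), of x' "[]"]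
    show ?case by simp
  qed auto
next
  fix x y assume "(x, y) \<in> (elem_trans u v)\<^sup>*"
  then show "(x, y) \<in> rel_cong u v"
  proof (induction rule: rtrancl_induct)
    case (step y z)
    have "(y, z) \<in> rel_cong u v"
      using step.hyps(2) by (auto simp: elem_trans_def intro!: rel_cong.append intro: rel_cong.intros)
    with step.IH show ?case by (rule rel_cong.trans)
  qed (rule rel_cong.refl)
qed

lemma trans_dist_attained:
  assumes "word_val u v x = word_val u v y"
  shows "(x, y) \<in> elem_trans u v ^^ trans_dist u v x y"
  unfolding trans_dist_def
  using assms by (auto simp: word_val_eq_iff rel_cong_eq_rtrancl rtrancl_power intro: LeastI)

lemma dehn_set_finite_nonempty:
  fixes u v :: "'a::finite list"
  defines "D n \<equiv>
    {trans_dist u v x y | x y. word_val u v x = word_val u v y \<and> length x + length y \<le> n}"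
  shows "finite (D n)" "D n \<noteq> {}"
proof -
  have fin: "finite {xs :: 'a list. length xs \<le> n}"
    using finite_lists_length_le[of "UNIV :: 'a set" n] by simp
  have "D n \<subseteq> (\<lambda>(x, y). trans_dist u v x y) ` ({xs. length xs \<le> n} \<times> {xs. length xs \<le> n})"
    by (force simp: D_def)
  then show "finite (D n)" using fin by (meson finite_SigmaI finite_imageI finite_subset)
  have "trans_dist u v [] [] \<in> D n" unfolding D_def by fastforce
  then show "D n \<noteq> {}" by blast
qed


section \<open>Recursive functions\<close>

text \<open>Programs for the partial recursive (Kleene) functions on tuples of naturals.\<close>

datatype recf =
    Zero
  | Succ
  | Proj nat
  | Comp recf "recf list"
  | Prec recf recf
  | Mini recf

text \<open>
  \<open>None\<close> stands for an undefined value. Recursion and minimisation run over the first argument.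
  Minimisation at \<open>xs\<close> is defined only if \<open>f\<close> has a zero \<open>z\<close> and is defined at all \<open>y < z\<close>.
\<close>

primrec rec_eval :: "recf \<Rightarrow> nat list \<Rightarrow> nat option" where
  "rec_eval Zero xs = Some 0"
| "rec_eval Succ xs = (case xs of [] \<Rightarrow> None | x # _ \<Rightarrow> Some (Suc x))"
| "rec_eval (Proj i) xs = (if i < length xs then Some (xs ! i) else None)"
| "rec_eval (Comp f gs) xs =
     (let ys = map (\<lambda>e. e xs) (map rec_eval gs)
      in if None \<in> set ys then None else rec_eval f (map the ys))"
| "rec_eval (Prec f g) xs =
     (case xs of
        [] \<Rightarrow> None
      | n # ys \<Rightarrow>
          rec_nat (rec_eval f ys)
            (\<lambda>m r. Option.bind r (\<lambda>y. rec_eval g (m # y # ys))) n)"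
| "rec_eval (Mini f) xs =
     (if \<exists>z. rec_eval f (z # xs) = Some 0 \<and> (\<forall>y<z. rec_eval f (y # xs) \<noteq> None)
      then Some (LEAST z. rec_eval f (z # xs) = Some 0)
      else None)"

definition recursive :: "(nat \<Rightarrow> nat) \<Rightarrow> bool" where
  "recursive h \<longleftrightarrow> (\<exists>f. \<forall>n. rec_eval f [n] = Some (h n))"


section \<open>The word problem over a two-letter alphabet\<close>

datatype letter = La | Lb

lemma UNIV_letter: "UNIV = {La, Lb}"
  using letter.exhaust by auto

instance letter :: finite
  by standard (simp add: UNIV_letter)

definition word_code :: "letter list \<Rightarrow> nat" where
  "word_code w = list_encode (map (case_letter 0 1) w)"

definition word_problem_decidable :: "letter list \<Rightarrow> letter list \<Rightarrow> bool" where
  "word_problem_decidable u v \<longleftrightarrow>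
     (\<exists>f. \<forall>w1 w2. rec_eval f [word_code w1, word_code w2] =
        Some (if word_val u v w1 = word_val u v w2 then 1 else 0))"

text \<open>The left-hand side \<open>baa(ba)\<^sup>N\<close> of the defining relation.\<close>

definition Pi_lhs :: "nat \<Rightarrow> letter list" where
  "Pi_lhs N = [Lb, La, La] @ concat (replicate N [Lb, La])"

end

theory Submission
  imports Defs
begin

text \<open>
  Put \<open>c = ba\<close>, so that the relation reads \<open>cac\<^sup>N = a\<close>. Then \<open>a = c\<^sup>kac\<^bsup>kN\<^esup>\<close>, and hence
  \<open>cac\<^bsup>N-k\<^esup>a = cac\<^sup>Nac\<^bsup>kN\<^esup> = aac\<^bsup>kN\<^esup>\<close> for \<open>1 \<le> k \<le> N\<close>. Reading these equations and
  \<open>cac\<^sup>N = a\<close> from left to right gives normal forms. They are unique because the monoid acts on them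
  by left multiplication. Irreducible words thus form a decidable set that meets
  every class exactly once, so two words are compared by searching for derivations from each of
  them to an irreducible word. With equality decidable, the Dehn function is found by bounded search.
\<close>

section \<open>Computable functions\<close>

text \<open>The rules can lengthen words: \<open>caa\<close> becomes \<open>aac^(N*N)\<close>.
  Neither termination nor confluence of the rewriting is proved. Instead, left multiplication by a
  letter is defined on the intended normal forms by structural recursion. Applied letter by letter,
  starting from the empty word, it turns every word into an equal normal form, respects the defining
  relation, and gives back each irreducible word unchanged. Hence irreducible words that are equal
  in the monoid coincide.

  The normal forms come from words in \<open>a\<close> and \<open>c\<close>: such a word without
  \<open>cac^N\<close> and without \<open>cac^ja\<close> for \<open>j < N\<close> is
  \<open>a^ic^k\<close> or \<open>a^ic^kac^j\<close> with \<open>k > 0\<close> and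
  \<open>j < N\<close>. The prefix \<open>a^i\<close> is cut into pairs because \<open>c\<close>
  passes \<open>aa\<close> whatever follows, while its effect on a single \<open>a\<close> depends
  on the next power of \<open>c\<close>.

  Exponents grow by the factor \<open>N*N\<close> at every such pair, but no bound on them is
  needed: that a normal form exists suffices for the search to end.\<close>

definition computable :: "nat \<Rightarrow> (nat list \<Rightarrow> nat) \<Rightarrow> bool" where
  "computable n f \<longleftrightarrow> (\<exists>p. \<forall>xs. length xs = n \<longrightarrow> rec_eval p xs = Some (f xs))"

definition decidable :: "nat \<Rightarrow> (nat list \<Rightarrow> bool) \<Rightarrow> bool" where
  "decidable n P \<longleftrightarrow> computable n (\<lambda>xs. of_bool (P xs))"

lemma computable_cong:
  assumes "computable n f" "\<And>xs. length xs = n \<Longrightarrow> g xs = f xs"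
  shows "computable n g"
  using assms unfolding computable_def by metis

lemma computable_nth: "i < n \<Longrightarrow> computable n (\<lambda>xs. xs ! i)"
  unfolding computable_def by (rule exI[of _ "Proj i"]) auto

lemma computable_compose:
  assumes f: "computable (length gs) f" and gs: "\<And>g. g \<in> set gs \<Longrightarrow> computable n g"
  shows "computable n (\<lambda>xs. f (map (\<lambda>g. g xs) gs))"
proof -
  obtain p where p: "\<And>ys. length ys = length gs \<Longrightarrow> rec_eval p ys = Some (f ys)"
    using f unfolding computable_def by blast
  have "\<forall>g\<in>set gs. \<exists>q. \<forall>xs. length xs = n \<longrightarrow> rec_eval q xs = Some (g xs)"
    using gs unfolding computable_def by blast
  then obtain q where q: "\<And>g xs. g \<in> set gs \<Longrightarrow> length xs = n \<Longrightarrow> rec_eval (q g) xs = Some (g xs)"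
    by metis
  have "rec_eval (Comp p (map q gs)) xs = Some (f (map (\<lambda>g. g xs) gs))" if "length xs = n" for xs
  proof -
    have eq: "map (\<lambda>e. e xs) (map rec_eval (map q gs)) = map (\<lambda>g. Some (g xs)) gs"
      using q that by simp
    have "map the (map (\<lambda>g. Some (g xs)) gs) = map (\<lambda>g. g xs) gs" by simp
    then show ?thesis using p[of "map (\<lambda>g. g xs) gs"] unfolding rec_eval.simps eq Let_def by (auto simp: comp_def)
  qed
  then show ?thesis unfolding computable_def by blast
qed

lemma computable_Suc: "computable n f \<Longrightarrow> computable n (\<lambda>xs. Suc (f xs))"
proof -
  assume f: "computable n f"
  have "computable 1 (\<lambda>xs. Suc (xs ! 0))"
    unfolding computable_def by (rule exI[of _ Succ]) (auto split: list.split)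
  from computable_compose[of "[f]" "\<lambda>xs. Suc (xs ! 0)" n] this f show ?thesis by simp
qed

lemma computable_const: "computable n (\<lambda>xs. c)"
proof (induction c)
  case 0
  show ?case unfolding computable_def by (rule exI[of _ Zero]) simp
qed (rule computable_Suc)

text \<open>Under a quantifier or a least-number search the bound variable is put in front of the
  argument list, so the old arguments are reached through \<open>tl\<close>.\<close>

lemma computable_tl:
  assumes "computable n f"
  shows "computable (Suc n) (\<lambda>xs. f (tl xs))"
proof -
  let ?gs = "map (\<lambda>i xs. xs ! Suc i) [0..<n]"
  have "computable (Suc n) (\<lambda>xs. f (map (\<lambda>g. g xs) ?gs))"
    using assms by (intro computable_compose) (auto intro: computable_nth)
  then show ?thesis
  proof (rule computable_cong)
    fix xs :: "nat list" assume "length xs = Suc n"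
    then have "tl xs = map (\<lambda>g. g xs) ?gs" by (intro nth_equalityI) (auto simp: nth_tl)
    then show "f (tl xs) = f (map (\<lambda>g. g xs) ?gs)" by simp
  qed
qed

lemma computable_rec_nat:
  assumes b: "computable n b"
    and s: "computable (Suc (Suc n)) (\<lambda>xs. s (xs ! 0) (tl xs ! 0) (tl (tl xs)))"
    and k: "computable n k"
  shows "computable n (\<lambda>xs. rec_nat (b xs) (\<lambda>m r. s m r xs) (k xs))"
proof -
  obtain p where p: "\<And>xs. length xs = n \<Longrightarrow> rec_eval p xs = Some (b xs)"
    using b unfolding computable_def by blast
  obtain q where q: "\<And>m r xs. length xs = n \<Longrightarrow> rec_eval q (m # r # xs) = Some (s m r xs)"
    using s unfolding computable_def
    by (metis length_Cons list.sel(3) nth_Cons_0)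
  have "rec_eval (Prec p q) (m # xs) = Some (rec_nat (b xs) (\<lambda>m r. s m r xs) m)"
    if "length xs = n" for m xs
    using p[OF that] q[OF that] by (induction m) auto
  then have rec: "computable (Suc n) (\<lambda>ys. rec_nat (b (tl ys)) (\<lambda>m r. s m r (tl ys)) (ys ! 0))"
    unfolding computable_def by (intro exI[of _ "Prec p q"]) (auto simp: length_Suc_conv simp del: rec_eval.simps)
  \<comment> \<open>\<open>Prec\<close> recurses over its first argument, so \<open>k xs\<close>
    goes in front of the unchanged arguments.\<close>
  let ?gs = "k # map (\<lambda>i xs. xs ! i) [0..<n]"
  have "computable n (\<lambda>xs. (\<lambda>ys. rec_nat (b (tl ys)) (\<lambda>m r. s m r (tl ys)) (ys ! 0)) (map (\<lambda>g. g xs) ?gs))"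
    using rec k by (intro computable_compose) (auto intro: computable_nth)
  then show ?thesis
  proof (rule computable_cong)
    fix xs :: "nat list" assume "length xs = n"
    then have "map (\<lambda>g. g xs) ?gs = k xs # xs" by (auto intro: nth_equalityI)
    then show "rec_nat (b xs) (\<lambda>m r. s m r xs) (k xs) =
      (\<lambda>ys. rec_nat (b (tl ys)) (\<lambda>m r. s m r (tl ys)) (ys ! 0)) (map (\<lambda>g. g xs) ?gs)" by simp
  qed
qed

section \<open>Closure under arithmetic, logical connectives, bounded quantifiers and search\<close>

named_theorems comp_intros

declare computable_nth [comp_intros] computable_Suc [comp_intros] computable_const [comp_intros]
  computable_tl [comp_intros]

lemma computable_add [comp_intros]:
  assumes "computable n a" "computable n b"
  shows "computable n (\<lambda>xs. a xs + b xs)"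
proof -
  have "x + y = rec_nat x (\<lambda>m r. Suc r) y" for x y :: nat by (induction y) auto
  then show ?thesis using assms by (simp only:) (intro comp_intros computable_rec_nat; simp)
qed

lemma computable_mult [comp_intros]:
  assumes "computable n a" "computable n b"
  shows "computable n (\<lambda>xs. a xs * b xs)"
proof -
  have "x * y = rec_nat 0 (\<lambda>m r. r + x) y" for x y :: nat by (induction y) auto
  then show ?thesis using assms by (simp only:) (intro comp_intros computable_rec_nat; simp)
qed

lemma computable_power [comp_intros]:
  assumes "computable n a" "computable n b"
  shows "computable n (\<lambda>xs. a xs ^ b xs)"
proof -
  have "x ^ y = rec_nat 1 (\<lambda>m r. r * x) y" for x y :: nat by (induction y) auto
  then show ?thesis using assms by (simp only:) (intro comp_intros computable_rec_nat; simp)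
qed

lemma computable_diff [comp_intros]:
  assumes "computable n a" "computable n b"
  shows "computable n (\<lambda>xs. a xs - b xs)"
proof -
  have pred: "computable n (\<lambda>xs. f xs - 1)" if "computable n f" for n f
  proof -
    have "x - 1 = rec_nat 0 (\<lambda>m r. m) x" for x :: nat by (cases x) auto
    then show ?thesis using that by (simp only:) (intro comp_intros computable_rec_nat; simp)
  qed
  have "computable n (\<lambda>xs. rec_nat (a xs) (\<lambda>m r. r - 1) (b xs))"
    using assms by (intro comp_intros pred computable_rec_nat; simp)
  moreover have "x - y = rec_nat x (\<lambda>m r. r - 1) y" for x y :: nat by (induction y) auto
  ultimately show ?thesis by (rule computable_cong)
qed

lemma decidable_le [comp_intros]:
  assumes "computable n a" "computable n b"
  shows "decidable n (\<lambda>xs. a xs \<le> b xs)"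
proof -
  have "of_bool (x \<le> y) = 1 - (x - y)" for x y :: nat by auto
  then show ?thesis unfolding decidable_def using assms by (simp only:) (intro comp_intros)
qed

lemma decidable_less [comp_intros]:
  assumes "computable n a" "computable n b"
  shows "decidable n (\<lambda>xs. a xs < b xs)"
  unfolding Suc_le_eq[symmetric] using assms by (intro comp_intros)

lemma decidable_not [comp_intros]:
  assumes "decidable n P"
  shows "decidable n (\<lambda>xs. \<not> P xs)"
proof -
  have "of_bool (\<not> x) = 1 - (of_bool x :: nat)" for x by auto
  then show ?thesis using assms unfolding decidable_def by (simp only:) (intro comp_intros)
qed

lemma decidable_conj [comp_intros]:
  assumes "decidable n P" "decidable n Q"
  shows "decidable n (\<lambda>xs. P xs \<and> Q xs)"
  using assms unfolding decidable_def of_bool_conj by (intro comp_intros)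

lemma decidable_disj [comp_intros]:
  assumes "decidable n P" "decidable n Q"
  shows "decidable n (\<lambda>xs. P xs \<or> Q xs)"
proof -
  have "decidable n (\<lambda>xs. \<not> (\<not> P xs \<and> \<not> Q xs))" using assms by (intro comp_intros)
  then show ?thesis by simp
qed

lemma decidable_imp [comp_intros]:
  assumes "decidable n P" "decidable n Q"
  shows "decidable n (\<lambda>xs. P xs \<longrightarrow> Q xs)"
  unfolding imp_conv_disj using assms by (intro comp_intros)

lemma decidable_eq [comp_intros]:
  assumes "computable n a" "computable n b"
  shows "decidable n (\<lambda>xs. a xs = b xs)"
  unfolding order_eq_iff using assms by (intro comp_intros)

lemma decidable_True [comp_intros]: "decidable n (\<lambda>xs. True)"
  unfolding decidable_def by (intro comp_intros)

lemma computable_if [comp_intros]: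
  assumes "decidable n P" "computable n a" "computable n b"
  shows "computable n (\<lambda>xs. if P xs then a xs else b xs)"
proof -
  have "(if x then y else z) = of_bool x * y + (1 - of_bool x) * z" for x and y z :: nat by auto
  then show ?thesis using assms unfolding decidable_def by (simp only:) (intro comp_intros)
qed

lemma decidable_ex_less [comp_intros]:
  assumes "computable n b" "decidable (Suc n) (\<lambda>xs. P (xs ! 0) (tl xs))"
  shows "decidable n (\<lambda>xs. \<exists>y<b xs. P y xs)"
proof -
  \<comment> \<open>On truth values \<open>r + (1 - r) * q\<close> is disjunction.\<close>
  have eq: "of_bool (\<exists>y<k. Q y) = rec_nat 0 (\<lambda>m r. r + (1 - r) * of_bool (Q m) :: nat) k" for k Q
  proof (induction k)
    case (Suc k)
    have "rec_nat 0 (\<lambda>m r. r + (1 - r) * of_bool (Q m) :: nat) (Suc k) =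
      of_bool (\<exists>y<k. Q y) + (1 - of_bool (\<exists>y<k. Q y)) * of_bool (Q k)"
      by (simp only: Suc.IH nat.rec)
    then show ?case by (auto simp: less_Suc_eq)
  qed simp
  \<comment> \<open>The recursion passes the counter, the accumulator and then the old arguments;
    \<open>P\<close> must skip the accumulator.\<close>
  have "computable (Suc (Suc n)) (\<lambda>xs. of_bool (P (xs ! 0) (tl (tl xs))))"
  proof -
    let ?gs = "(\<lambda>xs. xs ! 0) # map (\<lambda>i xs. xs ! Suc (Suc i)) [0..<n]"
    let ?f = "\<lambda>xs. of_bool (P (xs ! 0) (tl xs)) :: nat"
    have "computable (Suc (Suc n)) (\<lambda>xs. ?f (map (\<lambda>g. g xs) ?gs))"
      using assms(2) unfolding decidable_def
      by (intro computable_compose) (auto intro: computable_nth)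
    then show ?thesis
    proof (rule computable_cong)
      fix xs :: "nat list" assume l: "length xs = Suc (Suc n)"
      then have "tl (tl xs) = map (\<lambda>i. xs ! Suc (Suc i)) [0..<n]"
        by (intro nth_equalityI) (auto simp: nth_tl)
      then show "of_bool (P (xs ! 0) (tl (tl xs))) = ?f (map (\<lambda>g. g xs) ?gs)" by (simp add: comp_def)
    qed
  qed
  then show ?thesis unfolding decidable_def eq using assms(1)
    by (intro computable_rec_nat) (intro comp_intros; simp)+
qed

lemma decidable_all_less [comp_intros]:
  assumes "computable n b" "decidable (Suc n) (\<lambda>xs. P (xs ! 0) (tl xs))"
  shows "decidable n (\<lambda>xs. \<forall>y<b xs. P y xs)"
proof -
  have "decidable n (\<lambda>xs. \<not> (\<exists>y<b xs. \<not> P y xs))" using assms by (intro comp_intros)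
  then show ?thesis by simp
qed

lemma decidable_ex_le [comp_intros]:
  assumes "computable n b" "decidable (Suc n) (\<lambda>xs. P (xs ! 0) (tl xs))"
  shows "decidable n (\<lambda>xs. \<exists>y\<le>b xs. P y xs)"
  using assms unfolding less_Suc_eq_le[symmetric] by (intro comp_intros)

text \<open>The list is fixed, so the quantifier unrolls into a conjunction. Its elements need not
  be numbers; later they are words.\<close>

lemma decidable_Ball_set:
  assumes "\<And>e. e \<in> set es \<Longrightarrow> decidable n (P e)"
  shows "decidable n (\<lambda>xs. \<forall>e\<in>set es. P e xs)"
  using assms by (induction es) (auto intro!: comp_intros)

lemma computable_Least:
  assumes P: "decidable (Suc n) (\<lambda>xs. P (xs ! 0) (tl xs))"
    and ex: "\<And>xs. length xs = n \<Longrightarrow> \<exists>z. P z xs"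
  shows "computable n (\<lambda>xs. LEAST z. P z xs)"
proof -
  \<comment> \<open>\<open>Mini\<close> looks for a zero, and the truth value of the negation is
    zero exactly where \<open>P\<close> holds.\<close>
  have "decidable (Suc n) (\<lambda>xs. \<not> P (xs ! 0) (tl xs))" using P by (rule decidable_not)
  then obtain p where p: "\<And>z xs. length xs = n \<Longrightarrow> rec_eval p (z # xs) = Some (of_bool (\<not> P z xs))"
    unfolding decidable_def computable_def by (metis length_Cons list.sel(3) nth_Cons_0)
  have "rec_eval (Mini p) xs = Some (LEAST z. P z xs)" if "length xs = n" for xs
    using p[OF that] ex[OF that] by simp
  then show ?thesis unfolding computable_def by blast
qed

lemma computable_div [comp_intros]:
  assumes "computable n a" "computable n b"
  shows "computable n (\<lambda>xs. a xs div b xs)"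
proof -
  \<comment> \<open>The disjunct \<open>y = 0\<close> makes the search end at 0, which agrees with
    \<open>x div 0 = 0\<close>.\<close>
  have eq: "x div y = (LEAST q. y = 0 \<or> x < Suc q * y)" for x y :: nat
  proof (rule Least_equality[symmetric])
    show "y = 0 \<or> x < Suc (x div y) * y"
      by (metis dividend_less_div_times add.commute mult_Suc not_gr_zero)
  next
    fix q assume "y = 0 \<or> x < Suc q * y"
    then show "x div y \<le> q"
      by (metis div_by_0 le0 less_Suc_eq_le less_mult_imp_div_less)
  qed
  have "\<exists>q. y = 0 \<or> x < Suc q * y" for x y :: nat
    by (metis dividend_less_div_times add.commute mult_Suc not_gr_zero)
  then show ?thesis unfolding eq using assms
    by (intro computable_Least) (intro comp_intros; simp)+
qed

lemma computable_mod [comp_intros]: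
  assumes "computable n a" "computable n b"
  shows "computable n (\<lambda>xs. a xs mod b xs)"
  unfolding modulo_nat_def using assms by (intro comp_intros)

section \<open>Words and derivations as numbers\<close>

lemma computable_triangle [comp_intros]:
  "computable n a \<Longrightarrow> computable n (\<lambda>xs. triangle (a xs))"
  unfolding triangle_def by (intro comp_intros)

lemma computable_prod_encode [comp_intros]:
  "computable n a \<Longrightarrow> computable n b \<Longrightarrow> computable n (\<lambda>xs. prod_encode (a xs, b xs))"
  unfolding prod_encode_def by (simp, intro comp_intros)

section \<open>Binary numbering of words\<close>

primrec bits :: "letter list \<Rightarrow> nat" where
  "bits [] = 0"
| "bits (x # w) = case_letter 0 1 x + 2 * bits w"

text \<open>The first letter is the lowest digit and a leading digit 1 marks the length. Words thus
  correspond one to one to the positive numbers, and concatenation becomes arithmetic, unlike with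
  the nested pairs of \<open>word_code\<close>.\<close>

definition word_num :: "letter list \<Rightarrow> nat" where
  "word_num w = bits w + 2 ^ length w"

lemma word_num_Nil: "word_num [] = 1"
  by (simp add: word_num_def)

lemma word_num_Cons: "word_num (x # w) = case_letter 0 1 x + 2 * word_num w"
  by (simp add: word_num_def)

lemma bits_append: "bits (p @ q) = bits p + 2 ^ length p * bits q"
  by (induction p) auto

lemma word_num_append: "word_num (p @ q) = bits p + 2 ^ length p * word_num q"
  by (simp add: word_num_def bits_append power_add algebra_simps)

lemma bits_less: "bits w < 2 ^ length w"
  by (induction w) (auto split: letter.split)

lemma word_num_pos: "0 < word_num w"
  by (simp add: word_num_def)

lemma word_num_less: "word_num w < 2 ^ Suc (length w)"
  using bits_less[of w] by (simp add: word_num_def)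

lemma word_num_ge: "2 ^ length w \<le> word_num w"
  by (simp add: word_num_def)

lemma bits_surj: "m < 2 ^ i \<Longrightarrow> \<exists>w. length w = i \<and> bits w = m"
proof (induction i arbitrary: m)
  case (Suc i)
  then have "m div 2 < 2 ^ i" by auto
  then obtain w where w: "length w = i" "bits w = m div 2" using Suc.IH by blast
  have "bits ((if even m then La else Lb) # w) = m" using w by (auto elim: oddE)
  then show ?case using w by (metis length_Cons)
qed simp

lemma word_num_surj:
  assumes "0 < m"
  obtains w where "m = word_num w"
proof -
  obtain i where i: "2 ^ i \<le> m" "m < 2 ^ Suc i"
    using ex_power_ivl1[of 2 m] assms by auto
  then have "m - 2 ^ i < 2 ^ i" by simp
  then obtain w where "length w = i" "bits w = m - 2 ^ i" using bits_surj by blast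
  then show thesis using that[of w] i by (simp add: word_num_def)
qed

lemma word_num_eq_iff [simp]: "word_num x = word_num y \<longleftrightarrow> x = y"
proof
  show "word_num x = word_num y \<Longrightarrow> x = y"
  proof (induction x arbitrary: y)
    case Nil
    show ?case
    proof (cases y)
      case (Cons b y')
      have "2 * word_num y' \<le> 1"
        using Nil unfolding Cons word_num_Nil word_num_Cons by linarith
      then show ?thesis using word_num_pos[of y'] by linarith
    qed simp
  next
    case (Cons a x)
    show ?case
    proof (cases y)
      case Nil
      have "2 * word_num x \<le> 1"
        using Cons.prems unfolding Nil word_num_Nil word_num_Cons by linarith
      then show ?thesis using word_num_pos[of x] by linarith
    next
      case y: (Cons b y')
      from Cons.prems have "case_letter 0 1 a + 2 * word_num x = case_letter 0 1 b + 2 * word_num y'"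
        unfolding y word_num_Cons .
      then have "a = b \<and> word_num x = word_num y'"
        by (cases a; cases b; simp; presburger)
      then show ?thesis using Cons.IH y by simp
    qed
  qed
qed simp

section \<open>Elementary transformations and derivations as arithmetic predicates\<close>

text \<open>Here \<open>i\<close> is the length of the common prefix, \<open>p\<close> its digits
  and \<open>q\<close> the number of the common suffix, positive since 0 numbers no word. All three
  are bounded in terms of \<open>x\<close>, which makes the predicate decidable.\<close>

definition step_num :: "letter list \<Rightarrow> letter list \<Rightarrow> nat \<Rightarrow> nat \<Rightarrow> bool" where
  "step_num u v x y \<longleftrightarrow> (\<exists>i\<le>x. \<exists>p<2 ^ i. \<exists>q\<le>x. 0 < q \<and>
     x = p + 2 ^ i * (bits u + 2 ^ length u * q) \<and> y = p + 2 ^ i * (bits v + 2 ^ length v * q))"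

lemma decidable_step_num [comp_intros]:
  assumes "computable n x" "computable n y"
  shows "decidable n (\<lambda>xs. step_num u v (x xs) (y xs))"
  unfolding step_num_def by (intro comp_intros assms; simp)

lemma step_num_word_num:
  "step_num u v (word_num x) (word_num y) \<longleftrightarrow> (\<exists>p q. x = p @ u @ q \<and> y = p @ v @ q)"
proof
  assume "step_num u v (word_num x) (word_num y)"
  then obtain i p q where *: "p < 2 ^ i" "0 < q"
    "word_num x = p + 2 ^ i * (bits u + 2 ^ length u * q)"
    "word_num y = p + 2 ^ i * (bits v + 2 ^ length v * q)"
    unfolding step_num_def by blast
  obtain p' where p': "length p' = i" "bits p' = p" using bits_surj[OF *(1)] by blast
  obtain q' where "q = word_num q'" using word_num_surj[OF *(2)] .
  with * p' have "word_num x = word_num (p' @ u @ q')" "word_num y = word_num (p' @ v @ q')"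
    by (simp_all add: word_num_append)
  then show "\<exists>p q. x = p @ u @ q \<and> y = p @ v @ q" by auto
next
  assume "\<exists>p q. x = p @ u @ q \<and> y = p @ v @ q"
  then obtain p q where *: "x = p @ u @ q" "y = p @ v @ q" by blast
  have "word_num q \<le> 2 ^ length u * word_num q" "word_num (u @ q) \<le> 2 ^ length p * word_num (u @ q)"
    by simp_all
  then have q: "word_num q \<le> word_num x"
    unfolding * word_num_append[of p] using word_num_append[of u q] by linarith
  have "length p \<le> length x" using * by simp
  also have "\<dots> < 2 ^ length x" by simp
  finally have "length p \<le> word_num x" using word_num_ge[of x] by linarith
  then show "step_num u v (word_num x) (word_num y)"
    unfolding step_num_def
    using q word_num_pos[of q] bits_less[of p] *
    by (intro exI[of _ "length p"] conjI exI[of _ "bits p"] exI[of _ "word_num q"])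
      (auto simp: word_num_append)
qed

lemma step_num_pos: "step_num u v x y \<Longrightarrow> 0 < x \<and> 0 < y"
  unfolding step_num_def by auto

definition elem_num :: "letter list \<Rightarrow> letter list \<Rightarrow> nat \<Rightarrow> nat \<Rightarrow> bool" where
  "elem_num u v x y \<longleftrightarrow> step_num u v x y \<or> step_num v u x y"

lemma decidable_elem_num [comp_intros]:
  assumes "computable n x" "computable n y"
  shows "decidable n (\<lambda>xs. elem_num u v (x xs) (y xs))"
  unfolding elem_num_def by (intro comp_intros assms)

lemma elem_num_word_num: "elem_num u v (word_num x) (word_num y) \<longleftrightarrow> (x, y) \<in> elem_trans u v"
  unfolding elem_num_def step_num_word_num elem_trans_def by blast

lemma elem_num_pos: "elem_num u v x y \<Longrightarrow> 0 < x \<and> 0 < y"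
  unfolding elem_num_def using step_num_pos by blast

lemma length_elem_trans:
  "(x, y) \<in> elem_trans u v \<Longrightarrow> length y \<le> length x + (length u + length v)"
  unfolding elem_trans_def by auto

text \<open>A finite sequence becomes the digits of one number, so that quantifying over derivations
  is bounded quantification over numbers.\<close>

lemma ex_digits:
  fixes b :: nat
  assumes "\<And>i. i < n \<Longrightarrow> f i < b"
  shows "\<exists>l<b ^ n. \<forall>i<n. l div b ^ i mod b = f i"
  using assms
proof (induction n arbitrary: f)
  case (Suc n)
  from Suc.IH[of "\<lambda>i. f (Suc i)"] Suc.prems
  obtain l where l: "l < b ^ n" "\<And>i. i < n \<Longrightarrow> l div b ^ i mod b = f (Suc i)" by auto
  have f0: "f 0 < b" using Suc.prems by simp
  define l' where "l' = f 0 + b * l"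
  have "l' < b * Suc l" using f0 by (simp add: l'_def)
  also have "\<dots> \<le> b * b ^ n" using l(1) by (intro mult_le_mono) auto
  finally have less: "l' < b ^ Suc n" by simp
  have div: "l' div b = l" using f0 by (simp add: l'_def)
  have "l' div b ^ i mod b = f i" if "i < Suc n" for i
  proof (cases i)
    case 0
    then show ?thesis using f0 by (simp add: l'_def)
  next
    case (Suc j)
    then show ?thesis using l(2)[of j] that div by (simp add: div_mult2_eq)
  qed
  with less show ?case by blast
qed simp

text \<open>A step adds at most \<open>length u + length v\<close> letters, so every word reached
  within \<open>k\<close> steps from the word numbered \<open>x\<close> has a number below this
  base.\<close>

definition deriv_base :: "letter list \<Rightarrow> letter list \<Rightarrow> nat \<Rightarrow> nat \<Rightarrow> nat" where
  "deriv_base u v k x = 2 * x * 2 ^ ((length u + length v) * k)"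

text \<open>The \<open>k + 1\<close> words of a derivation are the digits of
  \<open>l\<close>.\<close>

definition deriv_num :: "letter list \<Rightarrow> letter list \<Rightarrow> nat \<Rightarrow> nat \<Rightarrow> nat \<Rightarrow> bool" where
  "deriv_num u v k x y \<longleftrightarrow> (\<exists>l<deriv_base u v k x ^ Suc k.
     l div deriv_base u v k x ^ 0 mod deriv_base u v k x = x \<and>
     l div deriv_base u v k x ^ k mod deriv_base u v k x = y \<and>
     (\<forall>i<k. elem_num u v (l div deriv_base u v k x ^ i mod deriv_base u v k x)
                          (l div deriv_base u v k x ^ Suc i mod deriv_base u v k x)))"

lemma decidable_deriv_num [comp_intros]:
  assumes "computable n k" "computable n x" "computable n y"
  shows "decidable n (\<lambda>xs. deriv_num u v (k xs) (x xs) (y xs))"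
  unfolding deriv_num_def deriv_base_def by (intro comp_intros assms; simp)

lemma deriv_num_word_num:
  "deriv_num u v k (word_num x) (word_num y) \<longleftrightarrow> (x, y) \<in> elem_trans u v ^^ k"
proof
  let ?b = "deriv_base u v k (word_num x)"
  assume "deriv_num u v k (word_num x) (word_num y)"
  then obtain l where l: "l div ?b ^ 0 mod ?b = word_num x" "l div ?b ^ k mod ?b = word_num y"
    "\<And>i. i < k \<Longrightarrow> elem_num u v (l div ?b ^ i mod ?b) (l div ?b ^ Suc i mod ?b)"
    unfolding deriv_num_def by blast
  \<comment> \<open>Digits related by \<open>elem_num\<close> are positive and the last one is
    given, so every digit numbers a word.\<close>
  have "\<exists>w. l div ?b ^ i mod ?b = word_num w" if "i \<le> k" for i
  proof (cases "i = k")
    case False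
    then show ?thesis using l(3)[of i] that elem_num_pos word_num_surj
      by (metis le_neq_implies_less)
  qed (use l in auto)
  then obtain f where f: "\<And>i. i \<le> k \<Longrightarrow> l div ?b ^ i mod ?b = word_num (f i)" by metis
  have "f 0 = x" using f[of 0] l(1) by simp
  moreover have "f k = y" using f[of k] l(2) by simp
  moreover have "(f i, f (Suc i)) \<in> elem_trans u v" if "i < k" for i
    using l(3)[OF that] f[of i] f[of "Suc i"] that elem_num_word_num by auto
  ultimately show "(x, y) \<in> elem_trans u v ^^ k" unfolding relpow_fun_conv by blast
next
  let ?b = "deriv_base u v k (word_num x)"
  let ?d = "length u + length v"
  assume "(x, y) \<in> elem_trans u v ^^ k"
  then obtain f where f: "f 0 = x" "f k = y" "\<And>i. i < k \<Longrightarrow> (f i, f (Suc i)) \<in> elem_trans u v"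
    unfolding relpow_fun_conv by blast
  have len: "length (f i) \<le> length x + ?d * i" if "i \<le> k" for i
    using that
  proof (induction i)
    case (Suc i)
    then show ?case using length_elem_trans[OF f(3), of i] by simp
  qed (simp add: f)
  have less: "word_num (f i) < ?b" if "i < Suc k" for i
  proof -
    have "?d * i \<le> ?d * k" using that by (intro mult_le_mono) auto
    then have "length (f i) \<le> length x + ?d * k" using len[of i] that by linarith
    then have "2 ^ Suc (length (f i)) \<le> (2::nat) ^ Suc (length x + ?d * k)"
      by (intro power_increasing) auto
    also have "\<dots> = 2 * 2 ^ length x * 2 ^ (?d * k)" by (simp add: power_add)
    also have "\<dots> \<le> ?b" unfolding deriv_base_def by (intro mult_le_mono word_num_ge) auto
    finally show ?thesis using word_num_less[of "f i"] by linarith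
  qed
  obtain l where "l < ?b ^ Suc k" "\<And>i. i < Suc k \<Longrightarrow> l div ?b ^ i mod ?b = word_num (f i)"
    using ex_digits[of "Suc k" "\<lambda>i. word_num (f i)" ?b] less by blast
  then show "deriv_num u v k (word_num x) (word_num y)"
    unfolding deriv_num_def using f
    by (intro exI[of _ l]) (auto simp: elem_num_word_num simp del: power_0 power_Suc)
qed

section \<open>Passage between the two codings of words\<close>

text \<open>The least number is the length of the word. Letters are read from the last to the first,
  because \<open>list_encode\<close> builds a list from its end.\<close>

definition code_num :: "nat \<Rightarrow> nat" where
  "code_num x = rec_nat 0
     (\<lambda>m r. Suc (prod_encode (x div 2 ^ ((LEAST l. x < 2 ^ Suc l) - Suc m) mod 2, r)))
     (LEAST l. x < 2 ^ Suc l)"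

lemma computable_code_num [comp_intros]:
  assumes "computable n x"
  shows "computable n (\<lambda>xs. code_num (x xs))"
proof -
  have "\<exists>l. x < 2 ^ Suc l" for x :: nat
    by (metis less_exp Suc_lessD)
  then have L: "computable n (\<lambda>xs. LEAST l. x xs < 2 ^ Suc l)"
    using assms by (intro computable_Least) (intro comp_intros; simp)+
  show ?thesis
    unfolding code_num_def using assms
    by (intro computable_rec_nat comp_intros L) simp_all
qed

lemma word_num_digit: "i < length w \<Longrightarrow> word_num w div 2 ^ i mod 2 = case_letter 0 1 (w ! i)"
proof (induction w arbitrary: i)
  case (Cons a w)
  show ?case
  proof (cases i)
    case 0
    then show ?thesis unfolding word_num_Cons by (simp split: letter.split)
  next
    case (Suc j)
    have "word_num (a # w) div 2 = word_num w" unfolding word_num_Cons by (simp split: letter.split)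
    then show ?thesis using Suc Cons by (simp add: div_mult2_eq)
  qed
qed simp

lemma word_code_Cons: "word_code (a # w) = Suc (prod_encode (case_letter 0 1 a, word_code w))"
  by (cases a) (simp_all add: word_code_def)

lemma code_num_word_num: "code_num (word_num w) = word_code w"
proof -
  have L: "(LEAST l. word_num w < 2 ^ Suc l) = length w"
  proof (rule Least_equality)
    show "length w \<le> l" if "word_num w < 2 ^ Suc l" for l
    proof -
      have "(2::nat) ^ length w < 2 ^ Suc l" using that word_num_ge[of w] by linarith
      then show ?thesis by (simp add: power_strict_increasing_iff del: power_Suc)
    qed
  qed (rule word_num_less)
  have "rec_nat 0 (\<lambda>m r. Suc (prod_encode (word_num w div 2 ^ (length w - Suc m) mod 2, r))) m
      = word_code (drop (length w - m) w)" if "m \<le> length w" for m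
    using that
  proof (induction m)
    case (Suc m)
    let ?i = "length w - Suc m"
    have i: "?i < length w" "Suc ?i = length w - m" using Suc.prems by auto
    have "drop ?i w = w ! ?i # drop (length w - m) w" using Cons_nth_drop_Suc[OF i(1)] i(2) by simp
    then have "word_code (drop ?i w) =
      Suc (prod_encode (case_letter 0 1 (w ! ?i), word_code (drop (length w - m) w)))"
      by (simp add: word_code_Cons)
    then show ?case using Suc word_num_digit[OF i(1)] by simp
  qed (simp add: word_code_def)
  from this[of "length w"] show ?thesis unfolding code_num_def L by simp
qed

lemma word_code_inject: "word_code x = word_code y \<longleftrightarrow> x = y"
proof -
  have "inj (case_letter 0 (1::nat))" by (rule injI) (auto split: letter.splits)
  then show ?thesis unfolding word_code_def by (simp add: inj_map_eq_map list_encode_eq del: One_nat_def)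
qed

text \<open>With \<open>word_num_less\<close> this puts the number of a word with code
  \<open>c\<close> below \<open>2 ^ Suc c\<close>, where the search in \<open>num_of_code\<close>
  stops.\<close>

lemma length_le_word_code: "length w \<le> word_code w"
proof (induction w)
  case (Cons a w)
  have "word_code w \<le> prod_encode (case_letter 0 1 a, word_code w)" by (rule le_prod_encode_2)
  then show ?case using Cons by (simp add: word_code_Cons)
qed simp

text \<open>The first disjunct is there only to bound the search on numbers that code no word.\<close>

definition num_of_code :: "nat \<Rightarrow> nat" where
  "num_of_code c = (LEAST x. x = 2 ^ Suc c \<or> (0 < x \<and> code_num x = c))"

lemma computable_num_of_code [comp_intros]:
  assumes "computable n c"
  shows "computable n (\<lambda>xs. num_of_code (c xs))"
  unfolding num_of_code_def using assms
  by (intro computable_Least) ((intro comp_intros; simp)+, blast)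

lemma num_of_code_word_code: "num_of_code (word_code w) = word_num w"
  unfolding num_of_code_def
proof (rule Least_equality)
  fix x assume x: "x = 2 ^ Suc (word_code w) \<or> (0 < x \<and> code_num x = word_code w)"
  have "(2::nat) ^ Suc (length w) \<le> 2 ^ Suc (word_code w)"
    using length_le_word_code by (intro power_increasing) auto
  then have "word_num w \<le> 2 ^ Suc (word_code w)" using word_num_less[of w] by linarith
  moreover have "x = word_num w" if "0 < x" "code_num x = word_code w"
    using that word_num_surj[of x] code_num_word_num word_code_inject by metis
  ultimately show "word_num w \<le> x" using x by auto
qed (simp add: code_num_word_num word_num_pos)

section \<open>Equality and the Dehn function from a decidable transversal\<close>

lemma decidable_compose1:
  assumes "decidable 1 (\<lambda>xs. P (xs ! 0))" "computable n a"
  shows "decidable n (\<lambda>xs. P (a xs))"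
  using computable_compose[of "[a]" "\<lambda>xs. of_bool (P (xs ! 0))" n] assms
  unfolding decidable_def by simp

lemma word_val_eq_iff_relpow:
  "word_val u v x = word_val u v y \<longleftrightarrow> (\<exists>k. (x, y) \<in> elem_trans u v ^^ k)"
  by (simp add: word_val_eq_iff rel_cong_eq_rtrancl rtrancl_power)

text \<open>Turns the maximum into a search for the least upper bound.\<close>

lemma eq_Max_iff_Least:
  fixes A :: "nat set"
  assumes "finite A" "A \<noteq> {}"
  shows "Max A = (LEAST m. \<forall>a\<in>A. a \<le> m)"
  using assms by (intro Least_equality[symmetric]) auto

text \<open>By \<open>ex\<close> the search for derivations into \<open>R\<close> always ends. The
  bound it returns then suffices to test equality, since by \<open>unique\<close> equal words have
  reached the same word of \<open>R\<close>.\<close>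

theorem decidable_transversal:
  assumes dec: "decidable 1 (\<lambda>xs. R (xs ! 0))"
    and ex: "\<And>x. \<exists>y. word_val u v x = word_val u v y \<and> R (word_num y)"
    and unique: "\<And>x y. R (word_num x) \<Longrightarrow> R (word_num y) \<Longrightarrow>
      word_val u v x = word_val u v y \<Longrightarrow> x = y"
  shows "word_problem_decidable u v" "recursive (dehn u v)"
proof -
  let ?D = "deriv_num u v"
  define found where "found x y t \<longleftrightarrow> (\<exists>z1\<le>t. \<exists>z2\<le>t. \<exists>k1\<le>t. \<exists>k2\<le>t.
    ?D k1 x z1 \<and> ?D k2 y z2 \<and> R z1 \<and> R z2)" for x y t
  \<comment> \<open>No word has number 0; the first two disjuncts make the search total.\<close>
  define time where "time x y = (LEAST t. x = 0 \<or> y = 0 \<or> found x y t)" for x y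
  \<comment> \<open>\<open>R z\<close> is not demanded: any common \<open>z\<close> proves equality,
    and equal words have one within \<open>time x y\<close>, namely their representative.\<close>
  define eqn where "eqn x y \<longleftrightarrow> (\<exists>z\<le>time x y. \<exists>k1\<le>time x y. \<exists>k2\<le>time x y. 0 < z \<and> ?D k1 x z \<and> ?D k2 y z)"
    for x y
  have found_ex: "\<exists>t. found (word_num x) (word_num y) t" for x y
  proof -
    obtain x' k1 where 1: "(x, x') \<in> elem_trans u v ^^ k1" "R (word_num x')"
      using ex[of x] word_val_eq_iff_relpow by metis
    obtain y' k2 where 2: "(y, y') \<in> elem_trans u v ^^ k2" "R (word_num y')"
      using ex[of y] word_val_eq_iff_relpow by metis
    show ?thesis unfolding found_def
      by (rule exI[of _ "word_num x' + word_num y' + k1 + k2"], rule exI[of _ "word_num x'"], simp,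
          rule exI[of _ "word_num y'"], simp, rule exI[of _ k1], simp, rule exI[of _ k2])
        (use 1 2 deriv_num_word_num in auto)
  qed
  have time_ex: "\<exists>t. x = 0 \<or> y = 0 \<or> found x y t" for x y
    using found_ex word_num_surj by (metis not_gr_zero)
  have found_pos: "0 < z" if "?D k (word_num x) z" for k x z
  proof (cases k)
    case 0
    then show ?thesis using that word_num_pos unfolding deriv_num_def by auto
  next
    case (Suc j)
    then show ?thesis using that elem_num_pos unfolding deriv_num_def by blast
  qed
  have eqn: "eqn (word_num x) (word_num y) \<longleftrightarrow> word_val u v x = word_val u v y" for x y
  proof
    assume "eqn (word_num x) (word_num y)"
    then obtain z k1 k2 where *: "0 < z" "?D k1 (word_num x) z" "?D k2 (word_num y) z"
      unfolding eqn_def by blast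
    then obtain w where "z = word_num w" using word_num_surj by metis
    then show "word_val u v x = word_val u v y"
      using * deriv_num_word_num word_val_eq_iff_relpow by metis
  next
    assume eq: "word_val u v x = word_val u v y"
    let ?t = "time (word_num x) (word_num y)"
    have "found (word_num x) (word_num y) ?t"
      using LeastI_ex[OF time_ex[of "word_num x" "word_num y"]] word_num_pos[of x] word_num_pos[of y]
      unfolding time_def[symmetric] by simp
    then obtain z1 z2 k1 k2 where *: "z1 \<le> ?t" "z2 \<le> ?t" "k1 \<le> ?t" "k2 \<le> ?t"
      "?D k1 (word_num x) z1" "?D k2 (word_num y) z2" "R z1" "R z2"
      unfolding found_def by blast
    obtain w1 w2 where w: "z1 = word_num w1" "z2 = word_num w2"
      using * found_pos word_num_surj by metis
    have "word_val u v w1 = word_val u v w2"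
      using eq * w deriv_num_word_num word_val_eq_iff_relpow by metis
    then have "w1 = w2" using unique * w by blast
    then show "eqn (word_num x) (word_num y)"
      unfolding eqn_def using * w word_num_pos by blast
  qed
  have comp_time: "computable n (\<lambda>xs. time (a xs) (b xs))" if "computable n a" "computable n b" for n a b
    unfolding time_def found_def
    by (intro computable_Least time_ex[unfolded found_def])
      (intro comp_intros that decidable_compose1[OF dec]; simp)
  have dec_eqn: "decidable n (\<lambda>xs. eqn (a xs) (b xs))" if "computable n a" "computable n b" for n a b
    unfolding eqn_def by (intro comp_intros that comp_time; simp)
  show "word_problem_decidable u v"
  proof -
    have "computable 2 (\<lambda>xs. if eqn (num_of_code (xs ! 0)) (num_of_code (xs ! 1)) then 1 else 0)"
      by (intro comp_intros dec_eqn; simp)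
    then obtain p where "\<And>xs. length xs = 2 \<Longrightarrow> rec_eval p xs =
        Some (if eqn (num_of_code (xs ! 0)) (num_of_code (xs ! 1)) then 1 else 0)"
      unfolding computable_def by blast
    from this[of "[word_code w1, word_code w2]" for w1 w2]
    have "rec_eval p [word_code w1, word_code w2] =
        Some (if word_val u v w1 = word_val u v w2 then 1 else 0)" for w1 w2
      by (simp add: num_of_code_word_code eqn)
    then show ?thesis unfolding word_problem_decidable_def by blast
  qed
  show "recursive (dehn u v)"
  proof -
    \<comment> \<open>\<open>Q n m\<close> says that \<open>m\<close> bounds all distances entering
      \<open>dehn u v n\<close>. The number \<open>i\<close> splits the total length
      \<open>n\<close> between the two words. The search for \<open>m\<close> ends because the set
      of distances is finite.\<close>
    define Q where "Q n m \<longleftrightarrow> (\<forall>x<2 ^ Suc n. \<forall>y<2 ^ Suc n.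
      0 < x \<and> 0 < y \<and> (\<exists>i\<le>n. x < 2 ^ Suc i \<and> y < 2 ^ Suc (n - i)) \<and> eqn x y \<longrightarrow> (\<exists>k\<le>m. ?D k x y))" for n m
    have lengths: "(\<exists>i\<le>n. word_num x < 2 ^ Suc i \<and> word_num y < 2 ^ Suc (n - i)) \<longleftrightarrow>
      length x + length y \<le> n" for x y n
    proof -
      have "word_num w < 2 ^ Suc i \<longleftrightarrow> length w \<le> i" for w i
      proof
        assume "word_num w < 2 ^ Suc i"
        then have "(2::nat) ^ length w < 2 ^ Suc i" using word_num_ge[of w] by linarith
        then show "length w \<le> i" by (simp add: power_strict_increasing_iff del: power_Suc)
      next
        assume "length w \<le> i"
        then have "(2::nat) ^ Suc (length w) \<le> 2 ^ Suc i" by (intro power_increasing) auto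
        then show "word_num w < 2 ^ Suc i" using word_num_less[of w] by linarith
      qed
      then show ?thesis by (auto intro!: exI[of _ "length x"])
    qed
    have dist: "(\<exists>k\<le>m. ?D k (word_num x) (word_num y)) \<longleftrightarrow> trans_dist u v x y \<le> m"
      if "word_val u v x = word_val u v y" for x y m
      unfolding deriv_num_word_num
      using trans_dist_attained[OF that] by (auto simp: trans_dist_def intro: Least_le le_trans)
    let ?S = "\<lambda>n. {trans_dist u v x y | x y. word_val u v x = word_val u v y \<and> length x + length y \<le> n}"
    have Q: "Q n m \<longleftrightarrow> (\<forall>d\<in>?S n. d \<le> m)" for n m
    proof
      assume q: "Q n m"
      show "\<forall>d\<in>?S n. d \<le> m"
      proof clarify
        fix x y assume xy: "word_val u v x = word_val u v y" "length x + length y \<le> n"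
        then have "(2::nat) ^ Suc (length x) \<le> 2 ^ Suc n" "(2::nat) ^ Suc (length y) \<le> 2 ^ Suc n"
          by (intro power_increasing; simp)+
        then have "word_num x < 2 ^ Suc n" "word_num y < 2 ^ Suc n"
          using word_num_less[of x] word_num_less[of y] by linarith+
        moreover have "\<exists>i\<le>n. word_num x < 2 ^ Suc i \<and> word_num y < 2 ^ Suc (n - i)"
          unfolding lengths by (rule xy)
        moreover have "eqn (word_num x) (word_num y)" unfolding eqn by (rule xy)
        ultimately have "\<exists>k\<le>m. ?D k (word_num x) (word_num y)"
          using q[unfolded Q_def, rule_format, of "word_num x" "word_num y"]
            word_num_pos[of x] word_num_pos[of y] by simp
        then show "trans_dist u v x y \<le> m" using dist xy by blast
      qed
    next
      assume s: "\<forall>d\<in>?S n. d \<le> m"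
      show "Q n m" unfolding Q_def
      proof (intro allI impI, elim conjE)
        fix x y :: nat
        assume *: "0 < x" "0 < y" "\<exists>i\<le>n. x < 2 ^ Suc i \<and> y < 2 ^ Suc (n - i)" "eqn x y"
        obtain x' y' where xy: "x = word_num x'" "y = word_num y'" using * word_num_surj by metis
        have "word_val u v x' = word_val u v y'" "length x' + length y' \<le> n"
          using *(3,4) unfolding xy eqn lengths by blast+
        then show "\<exists>k\<le>m. ?D k x y" unfolding xy using s dist by blast
      qed
    qed
    have dehn: "dehn u v n = (LEAST m. Q n m)" for n
      unfolding dehn_def Q using dehn_set_finite_nonempty by (intro eq_Max_iff_Least)
    have "\<exists>m. Q n m" for n
      unfolding Q using dehn_set_finite_nonempty(1)[of u v n]
      by (meson finite_nat_set_iff_bounded_le)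
    then have "computable 1 (\<lambda>xs. LEAST m. Q (xs ! 0) m)"
      unfolding Q_def by (intro computable_Least) (intro comp_intros dec_eqn; simp)+
    then obtain p where "\<And>xs. length xs = 1 \<Longrightarrow> rec_eval p xs = Some (LEAST m. Q (xs ! 0) m)"
      unfolding computable_def by blast
    from this[of "[n]" for n] have "rec_eval p [n] = Some (dehn u v n)" for n
      by (simp add: dehn)
    then show ?thesis unfolding recursive_def by blast
  qed
qed

section \<open>Normal forms\<close>

abbreviation Pi_eq :: "nat \<Rightarrow> letter list \<Rightarrow> letter list \<Rightarrow> bool" where
  "Pi_eq N x y \<equiv> word_val (Pi_lhs N) [La] x = word_val (Pi_lhs N) [La] y"

definition ba_pow :: "nat \<Rightarrow> letter list" where
  "ba_pow n = concat (replicate n [Lb, La])"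

lemma ba_pow_0 [simp]: "ba_pow 0 = []"
  and ba_pow_Suc [simp]: "ba_pow (Suc n) = Lb # La # ba_pow n"
  by (simp_all add: ba_pow_def)

lemma ba_pow_add: "ba_pow (m + n) = ba_pow m @ ba_pow n"
  by (simp add: ba_pow_def replicate_add)

lemma Pi_lhs_ba_pow: "Pi_lhs N = [Lb, La, La] @ ba_pow N"
  by (simp add: Pi_lhs_def ba_pow_def)

lemma word_val_cong:
  assumes "word_val u v x = word_val u v x'"
  shows "word_val u v (p @ x @ q) = word_val u v (p @ x' @ q)"
  using assms by (simp add: word_val_append)

lemma ba_pow_diff: "k \<le> m \<Longrightarrow> ba_pow m = ba_pow k @ ba_pow (m - k)"
  by (simp flip: ba_pow_add)

lemma Pi_eq_ba_pow: "Pi_eq N (ba_pow n @ La # ba_pow (n * N)) [La]"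
proof (induction n)
  case (Suc n)
  have base: "Pi_eq N (Pi_lhs N) [La]" by (simp add: word_val_eq_iff rel_cong.base)
  have "ba_pow (Suc n * N) = ba_pow (n * N) @ ba_pow N"
    by (simp add: add.commute flip: ba_pow_add)
  then show ?case
    using word_val_cong[OF Suc, of "[Lb, La]" "ba_pow N"] base by (simp add: Pi_lhs_ba_pow)
qed simp

lemma Pi_eq_ba_pow_diff:
  assumes "n * N \<le> k"
  shows "Pi_eq N (ba_pow n @ La # ba_pow k) (La # ba_pow (k - n * N))"
  using word_val_cong[OF Pi_eq_ba_pow[where N = N and n = n], of "[]" "ba_pow (k - n * N)"]
  by (simp add: ba_pow_diff[OF assms])

text \<open>The second \<open>a\<close> emits the factors \<open>c\<close> that complete
  \<open>c^k\<close> to \<open>c^(n*N)\<close>, which the first \<open>a\<close> then absorbs. The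
  case \<open>k = 0\<close> moves \<open>c^n\<close> across \<open>aa\<close>.\<close>

lemma Pi_eq_ba_pow_a_a:
  assumes "k \<le> n * N"
  shows "Pi_eq N (ba_pow n @ La # ba_pow k @ [La]) (La # La # ba_pow (N * (n * N - k)))"
  using word_val_cong[OF Pi_eq_ba_pow[where N = N and n = "n * N - k"], of "ba_pow n @ La # ba_pow k" "[]"]
    word_val_cong[OF Pi_eq_ba_pow[where N = N and n = n], of "[]" "La # ba_pow (N * (n * N - k))"]
  by (simp add: ba_pow_diff[OF assms] mult.commute[of N])

section \<open>Cores and their multiplication by \<open>a\<close> and powers of
  \<open>c\<close>\<close>

text \<open>
  With \<open>c = ba\<close>, the constructors stand for the words \<open>aaw\<close>, \<open>c\<^sup>k\<close>, \<open>c\<^sup>kac\<^sup>j\<close>, \<open>ac\<^sup>k\<close> and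
  \<open>ac\<^sup>kac\<^sup>j\<close>, where \<open>k > 0\<close> and \<open>j < N\<close> in the third and fifth.
\<close>

datatype core = AA core | C nat | CAC nat nat | AC nat | ACAC nat nat

primrec core_word :: "core \<Rightarrow> letter list" where
  "core_word (AA s) = La # La # core_word s"
| "core_word (C k) = ba_pow k"
| "core_word (CAC k j) = ba_pow k @ La # ba_pow j"
| "core_word (AC k) = La # ba_pow k"
| "core_word (ACAC k j) = La # ba_pow k @ La # ba_pow j"

primrec valid_core :: "nat \<Rightarrow> core \<Rightarrow> bool" where
  "valid_core N (AA s) = valid_core N s"
| "valid_core N (C k) = True"
| "valid_core N (CAC k j) = (0 < k \<and> j < N)"
| "valid_core N (AC k) = True"
| "valid_core N (ACAC k j) = (0 < k \<and> j < N)"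

text \<open>
  Left multiplication by \<open>c\<^sup>n\<close>. Having \<open>n\<close> as an argument, instead of iterating the
  multiplication by \<open>c\<close>, makes \<open>caa = aac\<^bsup>N\<^sup>2\<^esup>\<close> a primitive recursion.
\<close>

primrec c_mult :: "nat \<Rightarrow> core \<Rightarrow> nat \<Rightarrow> core" where
  "c_mult N (AA s) n = AA (c_mult N s (N * N * n))"
| "c_mult N (C k) n = C (n + k)"
| "c_mult N (CAC k j) n = CAC (n + k) j"
| "c_mult N (AC k) n = (if n * N \<le> k then AC (k - n * N) else CAC (n - k div N) (k mod N))"
| "c_mult N (ACAC k j) n =
     (if n * N < k then ACAC (k - n * N) j else AA (C (N * (n * N - k) + j)))"

primrec a_mult :: "core \<Rightarrow> core" where
  "a_mult (AA s) = AA (a_mult s)"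
| "a_mult (C k) = AC k"
| "a_mult (CAC k j) = ACAC k j"
| "a_mult (AC k) = AA (C k)"
| "a_mult (ACAC k j) = AA (CAC k j)"

text \<open>Left division by \<open>a\<close>; for valid cores it fails exactly when the word does
  not begin with \<open>a\<close>, so it tells whether a \<open>b\<close> put in front forms a new
  \<open>c\<close>.\<close>

primrec a_div :: "core \<Rightarrow> core option" where
  "a_div (AA s) = Some (a_mult s)"
| "a_div (C k) = None"
| "a_div (CAC k j) = None"
| "a_div (AC k) = Some (C k)"
| "a_div (ACAC k j) = Some (CAC k j)"

lemma core_word_a_mult [simp]: "core_word (a_mult s) = La # core_word s"
  by (induction s) auto

lemma a_mult_a_mult [simp]: "a_mult (a_mult s) = AA s"
  by (induction s) auto

lemma a_div_a_mult [simp]: "a_div (a_mult s) = Some s"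
  by (cases s) auto

lemma core_word_a_div: "a_div s = Some t \<Longrightarrow> core_word s = La # core_word t"
  by (cases s) auto

lemma valid_a_mult [simp]: "valid_core N (a_mult s) = valid_core N s"
  by (induction s) auto

lemma valid_a_div: "valid_core N s \<Longrightarrow> a_div s = Some t \<Longrightarrow> valid_core N t"
  by (cases s) auto

text \<open>If \<open>n * N = k\<close> in the \<open>ACAC\<close> clause, all of \<open>c^k\<close>
  is absorbed and two letters \<open>a\<close> meet. The strict test there sends this case to
  \<open>AA\<close> and keeps the middle exponent positive.\<close>

lemma valid_c_mult: "0 < N \<Longrightarrow> valid_core N s \<Longrightarrow> valid_core N (c_mult N s n)"
  by (induction s arbitrary: n) (auto simp: less_mult_imp_div_less not_le)

lemma c_mult_0: "valid_core N s \<Longrightarrow> c_mult N s 0 = s"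
  by (induction s) auto

text \<open>Makes \<open>n\<close> successive multiplications by \<open>c\<close> agree with a
  single call of \<open>c_mult\<close>.\<close>

lemma c_mult_add:
  assumes "0 < N" "valid_core N s"
  shows "c_mult N (c_mult N s m) n = c_mult N s (n + m)"
  using assms
proof (induction s arbitrary: m n)
  case (AC k)
  show ?case
  proof (cases "m * N \<le> k")
    case True
    define d where "d = k - m * N"
    have k: "k = d + m * N" using True d_def by simp
    show ?thesis using AC.prems unfolding k by (simp add: algebra_simps)
  next
    case False
    then have "k div N < m" by (simp add: less_mult_imp_div_less not_le)
    moreover have "\<not> (n + m) * N \<le> k" using False by (simp add: algebra_simps)
    ultimately show ?thesis using False by simp
  qed
next
  case (ACAC k j)
  show ?case
  proof (cases "m * N < k")
    case True
    define d where "d = k - m * N"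
    have k: "k = d + m * N" using True d_def by simp
    show ?thesis using True unfolding k by (simp add: algebra_simps)
  next
    case False
    define d where "d = m * N - k"
    have k: "m * N = k + d" using False d_def by simp
    have "(n + m) * N - k = n * N + d" "\<not> (n + m) * N < k" using k by (simp_all add: algebra_simps)
    moreover have "N * m - k = d" by (simp add: d_def mult.commute)
    ultimately show ?thesis using False by (simp add: distrib_left ac_simps)
  qed
qed (simp_all add: algebra_simps)

text \<open>The relation \<open>cac\<^sup>N = a\<close>, with \<open>c\<^sup>n\<close> in place of \<open>c\<close> so that the induction goes through.\<close>

lemma c_mult_a_mult_c_mult:
  assumes "0 < N" "valid_core N s"
  shows "c_mult N (a_mult (c_mult N s (N * n))) n = a_mult s"
  using assms
proof (induction s arbitrary: n)
  case (AA s)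
  from AA.IH[of "N * N * n"] AA.prems show ?case by (simp add: mult.assoc mult.left_commute)
next
  case (C k)
  then show ?case by (simp add: mult.commute)
next
  case (CAC k j)
  then show ?case by (simp add: mult.commute)
next
  case (AC k)
  show ?case
  proof (cases "N * n * N \<le> k")
    case True
    then show ?thesis by (simp add: algebra_simps)
  next
    case False
    then have "k div N < N * n" by (simp add: less_mult_imp_div_less not_le)
    \<comment> \<open>The outer multiplication yields \<open>AA\<close> with exponent
      \<open>N * (k div N) + k mod N\<close>, the original \<open>k\<close>.\<close>
    then have "N * (n * N - (N * n - k div N)) + k mod N = k"
      by (simp add: mult.commute[of n N])
    moreover have "\<not> n * N < N * n - k div N" by (simp add: mult.commute)
    ultimately show ?thesis using False by simp
  qed
next
  case (ACAC k j)
  show ?case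
  proof (cases "N * n * N < k")
    case True
    then show ?thesis by (simp add: algebra_simps)
  next
    case False
    define d where "d = N * n * N - k"
    have d: "N * N * n = d + k" using False by (simp add: d_def algebra_simps)
    have "j < N" "0 < k" using ACAC.prems by auto
    then have "j < k * N" by (metis One_nat_def Suc_leI less_le_trans mult_le_mono1 nat_mult_1)
    \<comment> \<open>So \<open>c^(d+k)\<close> meets \<open>ac^(N*d+j)\<close> in the second branch
      of the \<open>AC\<close> clause. As \<open>j < N\<close>, division by \<open>N\<close> gives
      quotient \<open>d\<close> and remainder \<open>j\<close>, and \<open>c^kac^j\<close> is
      restored.\<close>
    then have "\<not> (d + k) * N \<le> N * d + j" by (simp add: algebra_simps)
    then show ?thesis using False \<open>j < N\<close> by (simp add: d d_def[symmetric])
  qed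
qed

lemma core_word_c_mult:
  assumes "0 < N" "valid_core N s"
  shows "Pi_eq N (core_word (c_mult N s n)) (ba_pow n @ core_word s)"
  using assms
proof (induction s arbitrary: n)
  case (AA s)
  have "Pi_eq N ([La, La] @ core_word (c_mult N s (N * N * n)) @ [])
    ([La, La] @ (ba_pow (N * N * n) @ core_word s) @ [])"
    using AA by (intro word_val_cong) auto
  also have "\<dots> = word_val (Pi_lhs N) [La] ([] @ (ba_pow n @ [La, La]) @ core_word s)"
    using word_val_cong[OF Pi_eq_ba_pow_a_a[of 0 n N], where p = "[]" and q = "core_word s"]
    by (simp add: ac_simps)
  finally show ?case by simp
next
  case (AC k)
  show ?case
  proof (cases "n * N \<le> k")
    case True
    then show ?thesis using Pi_eq_ba_pow_diff by simp
  next
    case False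
    let ?q = "k div N"
    have le: "?q \<le> n" using False by (simp add: less_mult_imp_div_less not_le less_imp_le)
    have mod: "k - ?q * N = k mod N" by (simp add: minus_div_mult_eq_mod)
    \<comment> \<open>Only \<open>k div N\<close> of the factors \<open>c\<close> are absorbed; the
      others stay in front.\<close>
    have "Pi_eq N (ba_pow (n - ?q) @ (ba_pow ?q @ La # ba_pow k) @ [])
      (ba_pow (n - ?q) @ (La # ba_pow (k mod N)) @ [])"
      using Pi_eq_ba_pow_diff[of ?q N k] unfolding mod by (intro word_val_cong) simp
    then show ?thesis using False le by (simp flip: append_assoc ba_pow_add)
  qed
next
  case (ACAC k j)
  show ?case
  proof (cases "n * N < k")
    case True
    then show ?thesis
      using word_val_cong[OF Pi_eq_ba_pow_diff[of n N k], where p = "[]" and q = "La # ba_pow j"]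
      by simp
  next
    case False
    then show ?thesis
      using word_val_cong[OF Pi_eq_ba_pow_a_a[of k n N], where p = "[]" and q = "ba_pow j"]
      by (simp add: ba_pow_add)
  qed
qed (simp_all add: ba_pow_add)

section \<open>States and the action of words on them\<close>

text \<open>
  A nonempty list of cores stands for their words joined by single letters \<open>b\<close>. No core but the
  first begins with \<open>a\<close>, so that these letters form no further \<open>c = ba\<close>.
\<close>

primrec tail_word :: "core list \<Rightarrow> letter list" where
  "tail_word [] = []"
| "tail_word (s # ss) = Lb # core_word s @ tail_word ss"

fun state_word :: "core list \<Rightarrow> letter list" where
  "state_word [] = []"
| "state_word (s # ss) = core_word s @ tail_word ss"

fun valid_state :: "nat \<Rightarrow> core list \<Rightarrow> bool" where
  "valid_state N [] = False"
| "valid_state N (s # ss) = (valid_core N s \<and> (\<forall>t\<in>set ss. valid_core N t \<and> a_div t = None))"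

text \<open>A \<open>b\<close> before an \<open>a\<close> forms a \<open>c\<close>, which is
  multiplied onto the rest of the first core. Any other \<open>b\<close> becomes a separator, with
  the empty core \<open>C 0\<close> before it.\<close>

fun act :: "nat \<Rightarrow> letter \<Rightarrow> core list \<Rightarrow> core list" where
  "act N x [] = []"
| "act N La (s # ss) = a_mult s # ss"
| "act N Lb (s # ss) = (case a_div s of None \<Rightarrow> C 0 # s # ss | Some t \<Rightarrow> c_mult N t 1 # ss)"

lemma valid_act: "0 < N \<Longrightarrow> valid_state N st \<Longrightarrow> valid_state N (act N x st)"
  by (cases st; cases x) (auto split: option.split intro: valid_c_mult valid_a_div)

lemma state_word_act:
  assumes "0 < N" "valid_state N st"
  shows "Pi_eq N (state_word (act N x st)) (x # state_word st)"
proof -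
  obtain s ss where st: "st = s # ss" using assms by (cases st) auto
  have "Pi_eq N (core_word (c_mult N t 1) @ tail_word ss) (Lb # core_word s @ tail_word ss)"
    if "a_div s = Some t" for t
    using word_val_cong[OF core_word_c_mult[of N t 1], where p = "[]" and q = "tail_word ss"]
      assms that valid_a_div st core_word_a_div[OF that] by auto
  then show ?thesis by (cases x) (auto simp: st split: option.split)
qed

abbreviation acts :: "nat \<Rightarrow> letter list \<Rightarrow> core list \<Rightarrow> core list" where
  "acts N w st \<equiv> foldr (act N) w st"

lemma valid_acts: "0 < N \<Longrightarrow> valid_state N st \<Longrightarrow> valid_state N (acts N w st)"
  by (induction w) (auto intro: valid_act)

lemma acts_ba_pow:
  assumes "0 < N" "valid_core N s"
  shows "acts N (ba_pow n) (s # ss) = c_mult N s n # ss"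
  using assms c_mult_add[of N s _ 1] by (induction n) (auto simp: c_mult_0)

text \<open>Both sides change only the first core, where the claim is \<open>cac^N = a\<close>.
  Hence the action depends only on the element of the monoid.\<close>

lemma acts_Pi_lhs:
  assumes "0 < N" "valid_state N st"
  shows "acts N (Pi_lhs N) st = acts N [La] st"
proof -
  obtain s ss where st: "st = s # ss" "valid_core N s" using assms by (cases st) auto
  then show ?thesis
    using assms acts_ba_pow c_mult_a_mult_c_mult[of N s 1] by (simp add: Pi_lhs_ba_pow)
qed

definition normal_state :: "nat \<Rightarrow> letter list \<Rightarrow> core list" where
  "normal_state N w = acts N w [C 0]"

lemma valid_normal_state: "0 < N \<Longrightarrow> valid_state N (normal_state N w)"
  unfolding normal_state_def by (intro valid_acts) auto

lemma normal_state_Cons: "normal_state N (x # w) = act N x (normal_state N w)"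
  by (simp add: normal_state_def)

lemma state_word_normal_state: "0 < N \<Longrightarrow> Pi_eq N (state_word (normal_state N w)) w"
proof (induction w)
  case (Cons x w)
  have "Pi_eq N (state_word (normal_state N (x # w))) (x # state_word (normal_state N w))"
    unfolding normal_state_Cons using Cons.prems valid_normal_state by (intro state_word_act)
  also have "\<dots> = word_val (Pi_lhs N) [La] (x # w)" using word_val_cong[OF Cons.IH, of "[x]" "[]"] Cons.prems by simp
  finally show ?case .
qed (simp add: normal_state_def)

lemma normal_state_cong:
  assumes "0 < N" "Pi_eq N x y"
  shows "normal_state N x = normal_state N y"
proof -
  have "(x, y) \<in> (elem_trans (Pi_lhs N) [La])\<^sup>*"
    using assms by (simp add: word_val_eq_iff rel_cong_eq_rtrancl)
  then show ?thesis
  proof (induction rule: rtrancl_induct)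
    case (step y z)
    have "normal_state N (p @ Pi_lhs N @ q) = normal_state N (p @ [La] @ q)" for p q
      using acts_Pi_lhs[OF assms(1) valid_normal_state[OF assms(1), of q]]
      by (simp add: normal_state_def)
    then have "normal_state N y = normal_state N z" using step(2) by (auto simp: elem_trans_def)
    then show ?case using step by simp
  qed simp
qed

section \<open>Irreducible words\<close>

text \<open>Only the left-hand sides of the rules \<open>cac^N\<close> and \<open>cac^ja\<close> are
  recorded; no rewriting is carried out.\<close>

definition redexes :: "nat \<Rightarrow> letter list list" where
  "redexes N = Pi_lhs N # map (\<lambda>j. [Lb, La, La] @ ba_pow j @ [La]) [0..<N]"

definition irreducible :: "nat \<Rightarrow> letter list \<Rightarrow> bool" where
  "irreducible N w \<longleftrightarrow> (\<forall>r\<in>set (redexes N). \<nexists>p q. w = p @ r @ q)"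

text \<open>So no power of \<open>c\<close> in a core continues across the separator that follows
  it.\<close>

lemma tail_word_not:
  assumes "\<forall>t\<in>set ss. valid_core N t \<and> a_div t = None"
  shows "tail_word ss \<noteq> La # q" "tail_word ss \<noteq> Lb # La # q"
proof -
  show "tail_word ss \<noteq> La # q" by (cases ss) auto
  show "tail_word ss \<noteq> Lb # La # q"
  proof (cases ss)
    case (Cons t ts)
    have nLa: "tail_word ts \<noteq> La # q" for q by (cases ts) auto
    have "core_word t @ tail_word ts \<noteq> La # q"
    proof (cases t)
      case (C k)
      then show ?thesis using nLa by (cases k) auto
    next
      case (CAC k j)
      then show ?thesis using assms Cons by (cases k) auto
    qed (use assms Cons in auto)
    then show ?thesis using Cons by auto
  qed simp
qed

text \<open>If \<open>r\<close> begins neither with \<open>a\<close> nor with \<open>c\<close>, then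
  the initial power of \<open>c\<close> in \<open>c^jr\<close> is exactly \<open>c^j\<close>, and no
  \<open>a\<close> follows it.\<close>

lemma ba_pow_append_neq:
  assumes "\<And>q. r \<noteq> La # q" "\<And>q. r \<noteq> Lb # La # q"
  shows "ba_pow j @ r \<noteq> ba_pow i @ La # q" "j < m \<Longrightarrow> ba_pow j @ r \<noteq> ba_pow m @ q"
proof -
  show "ba_pow j @ r \<noteq> ba_pow i @ La # q"
  proof (induction j arbitrary: i)
    case 0
    show ?case using assms by (cases i) auto
  next
    case (Suc j)
    then show ?case by (cases i) auto
  qed
  show "j < m \<Longrightarrow> ba_pow j @ r \<noteq> ba_pow m @ q"
  proof (induction j arbitrary: m)
    case 0
    then show ?case using assms by (cases m) auto
  next
    case (Suc j)
    then show ?case by (cases m) auto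
  qed
qed

text \<open>Every redex begins with \<open>baa\<close>, which leaves only a first core
  \<open>CAC 1 j\<close>. Its final \<open>c^j\<close> is too short for \<open>c^N\<close> and is
  not followed by \<open>a\<close>.\<close>

lemma redex_not_prefix:
  assumes "valid_state N st" "F \<in> set (redexes N)"
  shows "state_word st \<noteq> F @ q"
proof
  assume eq: "state_word st = F @ q"
  obtain s ss where st: "st = s # ss" using assms by (cases st) auto
  have tail: "tail_word ss \<noteq> La # z" "tail_word ss \<noteq> Lb # La # z" for z
    using assms(1) tail_word_not[of ss N] by (auto simp: st)
  have "\<exists>z. F @ q = Lb # La # La # z \<and> (z = ba_pow N @ q \<or> (\<exists>j<N. z = ba_pow j @ La # q))"
    using assms(2) by (auto simp: redexes_def Pi_lhs_ba_pow)
  then obtain z where F: "F @ q = Lb # La # La # z"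
    and z: "z = ba_pow N @ q \<or> (\<exists>j<N. z = ba_pow j @ La # q)" by blast
  have w: "core_word s @ tail_word ss = Lb # La # La # z" using eq F st by simp
  show False
  proof (cases s)
    case (C k)
    then show False using w tail by (cases k rule: nat.exhaust; cases "k - 1") auto
  next
    case (CAC k j)
    have v: "0 < k" "j < N" using assms(1) CAC st by auto
    show False
    proof (cases "k = 1")
      case True
      then have "ba_pow j @ tail_word ss = z" using w CAC by simp
      then show False using z ba_pow_append_neq[of "tail_word ss" j, OF tail] v by blast
    next
      case False
      then obtain k' where "k = Suc (Suc k')" using v by (metis One_nat_def gr0_implies_Suc not0_implies_Suc)
      then show False using w CAC by simp
    qed
  qed (use w in auto)
qed

text \<open>A redex anywhere in a state word is thus a prefix of some state word, so excluding
  prefixes suffices.\<close>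

lemma state_word_suffix:
  assumes "valid_state N st" "state_word st = p @ z"
  shows "\<exists>st'. valid_state N st' \<and> state_word st' = z"
  using assms
proof (induction p arbitrary: st)
  case (Cons x p)
  obtain s ss where st: "st = s # ss" using Cons.prems by (cases st) auto
  have "\<exists>st'. valid_state N st' \<and> state_word st' = p @ z"
  proof (cases "a_div s")
    case (Some t)
    then show ?thesis using Cons.prems valid_a_div core_word_a_div st
      by (intro exI[of _ "t # ss"]) auto
  next
    case None
    show ?thesis
    proof (cases s)
      case (C k)
      show ?thesis
      proof (cases k)
        case 0
        then show ?thesis using C Cons.prems st by (intro exI[of _ ss]) (cases ss; auto)
      next
        case (Suc k')
        then show ?thesis using C Cons.prems st by (intro exI[of _ "AC k' # ss"]) auto
      qed
    next
      case (CAC k j)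
      then obtain k' where k: "k = Suc k'" using Cons.prems st by (cases k) auto
      show ?thesis
      proof (cases k')
        case 0
        \<comment> \<open>\<open>ACAC 0 j\<close> is not valid; the remaining \<open>aac^j\<close>
          is represented by \<open>AA (C j)\<close>.\<close>
        then show ?thesis using CAC k Cons.prems st by (intro exI[of _ "AA (C j) # ss"]) auto
      next
        case (Suc i)
        then show ?thesis using CAC k Cons.prems st by (intro exI[of _ "ACAC k' j # ss"]) auto
      qed
    qed (use None in auto)
  qed
  then show ?case using Cons.IH by blast
qed auto

lemma irreducible_state_word: "valid_state N st \<Longrightarrow> irreducible N (state_word st)"
  unfolding irreducible_def using redex_not_prefix state_word_suffix by metis

lemma irreducible_ConsD:
  assumes "irreducible N (x # w)"
  shows "irreducible N w"
  unfolding irreducible_def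
proof (intro ballI notI, elim exE)
  fix F p q assume "F \<in> set (redexes N)" "w = p @ F @ q"
  then have "x # w = (x # p) @ F @ q" by simp
  then show False using assms \<open>F \<in> set (redexes N)\<close> unfolding irreducible_def by blast
qed

text \<open>On an irreducible word the action merely prepends letters, since absorbing or moving a
  \<open>c\<close> would need a redex at the front. The word can therefore be read off its normal
  state.\<close>

lemma state_word_normal_state_irreducible:
  assumes "0 < N" "irreducible N w"
  shows "state_word (normal_state N w) = w"
  using assms(2)
proof (induction w)
  case (Cons x w)
  define st where "st = normal_state N w"
  have w: "state_word st = w" using Cons irreducible_ConsD unfolding st_def by blast
  obtain s ss where st: "st = s # ss"
    using valid_normal_state[OF assms(1), of w] unfolding st_def[symmetric] by (cases st) auto
  have no: "x # w \<noteq> F @ q" if "F \<in> set (redexes N)" for F q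
    using Cons.prems that unfolding irreducible_def by (metis append_Nil)
  have "state_word (act N x (s # ss)) = x # w"
  proof (cases x)
    case La
    then show ?thesis using w st by simp
  next
    case Lb
    show ?thesis
    proof (cases "a_div s")
      case None
      then show ?thesis using Lb w st by simp
    next
      case (Some t)
      have xw: "x # w = Lb # La # core_word t @ tail_word ss"
        using w st Lb core_word_a_div[OF Some] by simp
      \<comment> \<open>The next two facts exclude \<open>ACAC\<close> together, and the second
        excludes \<open>AA\<close>. For \<open>AC k\<close> the first gives \<open>k < N\<close>, so
        the new \<open>c\<close> stays in front as \<open>CAC 1 k\<close>.\<close>
      have big: "k < N" if "core_word t @ tail_word ss = La # ba_pow k @ z" for k z
      proof (rule ccontr)
        assume "\<not> k < N"
        then have "x # w = Pi_lhs N @ (ba_pow (k - N) @ z)"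
          using xw that ba_pow_diff[of N k] by (simp add: Pi_lhs_ba_pow)
        then show False using no[of "Pi_lhs N"] by (simp add: redexes_def)
      qed
      have small: "N \<le> k" if "core_word t @ tail_word ss = La # ba_pow k @ La # z" for k z
      proof (rule ccontr)
        assume "\<not> N \<le> k"
        then have "[Lb, La, La] @ ba_pow k @ [La] \<in> set (redexes N)" by (auto simp: redexes_def)
        then show False using no[of "[Lb, La, La] @ ba_pow k @ [La]" z] xw that by simp
      qed
      have "core_word (c_mult N t 1) @ tail_word ss = x # w"
      proof (cases t)
        case (AA t')
        then show ?thesis using small[of 0] assms(1) by simp
      next
        case (AC k)
        then show ?thesis using big[of k] xw by simp
      next
        case (ACAC k j)
        then show ?thesis
          using big[of k "La # ba_pow j @ tail_word ss"] small[of k "ba_pow j @ tail_word ss"] by simp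
      qed (use xw in auto)
      then show ?thesis using Lb Some by simp
    qed
  qed
  then show ?case unfolding normal_state_Cons st_def[symmetric] st .
qed (simp add: normal_state_def)

theorem theorem2:
  fixes N :: nat
  assumes "N \<ge> 2"
  shows "word_problem_decidable (Pi_lhs N) [La] \<and> recursive (dehn (Pi_lhs N) [La])"
proof -
  have N: "0 < N" using assms by simp
  \<comment> \<open>Replacing \<open>r\<close> by itself changes nothing, so
    \<open>step_num r r x x\<close> says that \<open>r\<close> occurs in the word numbered
    \<open>x\<close>.\<close>
  define R where "R x \<longleftrightarrow> (\<forall>r\<in>set (redexes N). \<not> step_num r r x x)" for x
  have R: "R (word_num w) \<longleftrightarrow> irreducible N w" for w
    unfolding R_def irreducible_def step_num_word_num by simp
  have "decidable 1 (\<lambda>xs. R (xs ! 0))"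
    unfolding R_def by (intro decidable_Ball_set comp_intros) simp_all
  moreover have "\<exists>y. Pi_eq N x y \<and> R (word_num y)" for x
    unfolding R using state_word_normal_state irreducible_state_word valid_normal_state N by metis
  moreover have "x = y" if "R (word_num x)" "R (word_num y)" "Pi_eq N x y" for x y
    using that state_word_normal_state_irreducible normal_state_cong N unfolding R by metis
  ultimately show ?thesis using decidable_transversal[of R] by blast
qed

end
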